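(* Let $(\Omega,\mu,d)$ be a metric measure space satisfying the standing assumptions, and let $w:\Omega\to\mathbb{R}_+$ be a measurable function with $w>0$ a.e. Then $w$ is an isoperimetric weight if and only if $W:=\frac1w$ belongs to the Marcinkiewicz space $M(\Phi)(\Omega)$.
   Context: Setting and standing assumptions. $(\Omega,\mu,d)$ is a connected metric space with a Borel measure $\mu$ such that $\mu(K)<\infty$ for every compact $K\subset\Omega$. For a Borel set $A\subset\Omega$, $\mu^+(A)=\liminf_{h\to0}\frac{\mu(A_h)-\mu(A)}{h}$, where $A_h=\{x\in\Omega:d(x,A)<h\}$. The isoperimetric profile is $I:[0,\mu(\Omega))\to\mathbb{R}_+$, $I(t)=\inf\{\mu^+(A):\mu(A)=t\}$. It is assumed throughout that $I$ is concave, continuous and $I(0)=0$; when $\mu(\Omega)<\infty$ it is also assumed that $I$ is symmetric around $\mu(\Omega)/2$ (so $I$ is increasing on $(0,\mu(\Omega)/2)$ and decreasing on $(\mu(\Omega)/2,\mu(\Omega))$); when $\mu(\Omega)=\infty$ it is assumed that $I$ is increasing. It is understood that $I>0$ on $(0,\mu(\Omega))$. The function $\Phi$. $\Phi(t)=\frac{\min\{t,\mu(\Omega)/2\}}{I(\min\{t,\mu(\Omega)/2\})}$ for $t\in(0,\mu(\Omega))$; it is non-decreasing. It is read as $0$ at $t=0$ and as its limit at $t=\mu(\Omega)$ (including $\mu(\Omega)=\infty$). Isoperimetric weight. A measurable $w:\Omega\to\mathbb{R}_+$ with $w>0$ a.e. is an isoperimetric weight if there is a constant $C=C(w)>0$ such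 that $\Phi(\mu(\{w\le r\}))\le Cr$ for all $r>0$. Marcinkiewicz space. $M(\Phi)(\Omega)$ consists of the measurable $f$ on $\Omega$ with $\|f\|_{M(\Phi)}=\sup_{t>0}t\,\Phi(\mu_f(t))<\infty$, where $\mu_f(t)=\mu\{x\in\Omega:|f(x)|>t\}$. *)

theory Defs
  imports "HOL-Analysis.Analysis"
begin

text \<open>
  The distance to a set is taken in \<^typ>\<open>ennreal\<close>, so that the distance to the empty set is
  infinite and the empty set has empty neighbourhoods. (With \<^const>\<open>infdist\<close>, the distance
  to the empty set would be 0.)
\<close>

definition set_dist :: "'a::metric_space \<Rightarrow> 'a set \<Rightarrow> ennreal" where
  "set_dist x A = (INF a\<in>A. ennreal (dist x a))"

definition neighbourhood :: "'a::metric_space set \<Rightarrow> real \<Rightarrow> 'a set" where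
  "neighbourhood A h = {x. set_dist x A < ennreal h}"

text \<open>
  Only used for sets of finite measure, where the difference in \<^typ>\<open>ennreal\<close> is the true one.
\<close>

definition boundary_measure :: "'a::metric_space measure \<Rightarrow> 'a set \<Rightarrow> ennreal" where
  "boundary_measure M A =
     Liminf (at_right (0::real))
       (\<lambda>h. (emeasure M (neighbourhood A h) - emeasure M A) / ennreal h)"

definition iso_profile :: "'a::metric_space measure \<Rightarrow> ennreal \<Rightarrow> ennreal" where
  "iso_profile M t = (INF A\<in>{A \<in> sets M. emeasure M A = t}. boundary_measure M A)"

definition iso_dom :: "'a measure \<Rightarrow> real set" where
  "iso_dom M = {t. 0 \<le> t \<and> ennreal t < emeasure M (space M)}"

text \<open>
  The real-valued form of the profile, meaningful on \<^term>\<open>iso_dom M\<close>, where the profile is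
  assumed to be finite.
\<close>

definition iso_profile_real :: "'a::metric_space measure \<Rightarrow> real \<Rightarrow> real" where
  "iso_profile_real M t = enn2real (iso_profile M (ennreal t))"

text \<open>
  In the finite case, monotonicity of the profile on the two halves of its domain follows from
  concavity and symmetry, so it is not assumed.
\<close>

locale isoperimetric_space =
  fixes M :: "'a::metric_space measure"
  assumes connected_space: "connected (UNIV :: 'a set)"
    and sets_eq_borel: "sets M = sets borel"
    and finite_on_compact: "\<And>K. compact K \<Longrightarrow> emeasure M K < \<infinity>"
    and profile_finite: "\<And>t. t \<in> iso_dom M \<Longrightarrow> iso_profile M (ennreal t) < \<infinity>"
    and profile_concave: "concave_on (iso_dom M) (iso_profile_real M)"
    and profile_continuous: "continuous_on (iso_dom M) (iso_profile_real M)"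
    and profile_zero: "iso_profile M 0 = 0"
    and profile_pos: "\<And>t. t \<in> iso_dom M \<Longrightarrow> 0 < t \<Longrightarrow> 0 < iso_profile M (ennreal t)"
    and profile_symmetric:
      "\<And>t. emeasure M (space M) < \<infinity> \<Longrightarrow> 0 < t \<Longrightarrow> t < measure M (space M) \<Longrightarrow>
         iso_profile_real M (measure M (space M) - t) = iso_profile_real M t"
    and profile_mono:
      "emeasure M (space M) = \<infinity> \<Longrightarrow> mono_on (iso_dom M) (iso_profile_real M)"

definition Phi_interior :: "'a::metric_space measure \<Rightarrow> ennreal \<Rightarrow> ennreal" where
  "Phi_interior M t =
     min t (emeasure M (space M) / 2) / iso_profile M (min t (emeasure M (space M) / 2))"

text \<open>
  The formula applies strictly between 0 and the total measure. The last case is the value at the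
  total measure, which may be infinite; arguments beyond the total measure never occur.
\<close>

definition Phi :: "'a::metric_space measure \<Rightarrow> ennreal \<Rightarrow> ennreal" where
  "Phi M t =
     (if t = 0 then 0
      else if t < emeasure M (space M) then Phi_interior M t
      else Lim (at_left (emeasure M (space M))) (Phi_interior M))"

definition isoperimetric_weight :: "'a::metric_space measure \<Rightarrow> ('a \<Rightarrow> real) \<Rightarrow> bool" where
  "isoperimetric_weight M w \<longleftrightarrow>
     w \<in> borel_measurable M \<and> (\<forall>x. 0 \<le> w x) \<and> (AE x in M. 0 < w x) \<and>
     (\<exists>C>0. \<forall>r>0. Phi M (emeasure M {x \<in> space M. w x \<le> r}) \<le> ennreal (C * r))"

definition distribution :: "'a measure \<Rightarrow> ('a \<Rightarrow> real) \<Rightarrow> real \<Rightarrow> ennreal" where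
  "distribution M f t = emeasure M {x \<in> space M. t < \<bar>f x\<bar>}"

definition marcinkiewicz_norm ::
  "'a measure \<Rightarrow> (ennreal \<Rightarrow> ennreal) \<Rightarrow> ('a \<Rightarrow> real) \<Rightarrow> ennreal" where
  "marcinkiewicz_norm M \<phi> f = (SUP t\<in>{0<..}. ennreal t * \<phi> (distribution M f t))"

definition marcinkiewicz_space ::
  "'a measure \<Rightarrow> (ennreal \<Rightarrow> ennreal) \<Rightarrow> ('a \<Rightarrow> real) set" where
  "marcinkiewicz_space M \<phi> = {f \<in> borel_measurable M. marcinkiewicz_norm M \<phi> f < \<infinity>}"

end

theory Submission
  imports Defs
begin

text \<open>
  Since \<open>I\<close> is concave with \<open>I 0 = 0\<close>, the ratio \<open>I t / t\<close> is non-increasing, so \<open>\<Phi>\<close> is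
  non-decreasing. Almost everywhere \<open>t < 1 / w\<close> means \<open>w < 1 / t\<close>, so the two conditions
  differ only by strict versus non-strict inequality in the sublevel sets of \<open>w\<close>. The inclusions
  \<open>{w < r} \<subseteq> {w \<le> r} \<subseteq> {w < 2 * r}\<close> then compare them up to a factor of 2.
\<close>

lemma tendsto_at_left_SUP:
  fixes f :: "'a::{linorder_topology, dense_order} \<Rightarrow> 'b::{complete_linorder, linorder_topology}"
  assumes "a < b" and mono: "mono_on {a<..<b} f"
  shows "(f \<longlongrightarrow> (SUP x\<in>{a<..<b}. f x)) (at_left b)"
proof (rule order_tendstoI)
  fix y assume "y < (SUP x\<in>{a<..<b}. f x)"
  then obtain x where x: "a < x" "x < b" "y < f x"
    by (auto simp: less_SUP_iff)
  have "y < f z" if "x < z" "z < b" for z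
  proof -
    have "f x \<le> f z"
      using x that by (intro mono_onD[OF mono]) auto
    with x(3) show ?thesis by (rule less_le_trans)
  qed
  then show "\<forall>\<^sub>F x in at_left b. y < f x"
    using x by (auto simp: eventually_at_left[OF \<open>a < b\<close>])
next
  fix y assume y: "(SUP x\<in>{a<..<b}. f x) < y"
  have "f z < y" if "a < z" "z < b" for z
  proof -
    have "f z \<le> (SUP x\<in>{a<..<b}. f x)"
      using that by (intro SUP_upper) simp
    then show ?thesis using y by (rule le_less_trans)
  qed
  then show "\<forall>\<^sub>F x in at_left b. f x < y"
    using \<open>a < b\<close> by (auto simp: eventually_at_left[OF \<open>a < b\<close>])
qed

text \<open>\<open>Lim\<close> is a definite description, so the value of \<open>Phi\<close> at the
  total measure is usable only once the limit is known to exist and be unique.\<close>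

lemma Lim_at_left_eq_SUP:
  fixes f :: "'a::{linorder_topology, dense_order} \<Rightarrow> 'b::{complete_linorder, linorder_topology}"
  assumes "a < b" "mono_on {a<..<b} f"
  shows "Lim (at_left b) f = (SUP x\<in>{a<..<b}. f x)"
proof (rule tendsto_Lim)
  show "at_left b \<noteq> bot"
    unfolding trivial_limit_def eventually_at_left[OF \<open>a < b\<close>] using dense by blast
qed (rule tendsto_at_left_SUP[OF assms])

context isoperimetric_space
begin

lemma iso_profile_eq_real:
  "t \<in> iso_dom M \<Longrightarrow> iso_profile M (ennreal t) = ennreal (iso_profile_real M t)"
  unfolding iso_profile_real_def using profile_finite by (simp add: ennreal_enn2real)

lemma iso_profile_real_pos:
  "t \<in> iso_dom M \<Longrightarrow> 0 < t \<Longrightarrow> 0 < iso_profile_real M t"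
  using profile_pos[of t] iso_profile_eq_real[of t] by (metis ennreal_eq_0_iff not_le order_less_irrefl)

text \<open>Concavity is a statement about the real-valued profile. On \<open>iso_dom M\<close> the
  profile is finite, and positive away from 0, so the \<open>ennreal\<close> quotients are real
  quotients and the comparison can be made there.\<close>

lemma div_iso_profile_mono:
  assumes "0 < s" "s \<le> t" "t < emeasure M (space M)"
  shows "s / iso_profile M s \<le> t / iso_profile M t"
proof -
  let ?f = "iso_profile_real M"
  obtain b where b: "t = ennreal b" "0 \<le> b"
    using assms by (cases t) auto
  obtain a where a: "s = ennreal a" "0 \<le> a"
    using assms b by (cases s) (auto simp: top_unique)
  have ab: "0 < a" "a \<le> b" "0 < b"
    using assms a b by auto
  have "s < emeasure M (space M)" "0 < emeasure M (space M)"
    using assms by order+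
  then have dom: "a \<in> iso_dom M" "b \<in> iso_dom M" "0 \<in> iso_dom M"
    using assms a b by (auto simp: iso_dom_def)
  have pos: "0 < ?f a" "0 < ?f b"
    using iso_profile_real_pos dom ab by auto
  have "?f 0 = 0"
    by (simp add: iso_profile_real_def profile_zero)
  \<comment> \<open>The point \<open>a\<close> is the convex combination of \<open>0\<close> and
    \<open>b\<close> with weight \<open>a / b\<close> on \<open>b\<close>.\<close>
  moreover have "(1 - a / b) * ?f 0 + (a / b) * ?f b \<le> ?f ((1 - a / b) * 0 + (a / b) * b)"
    using concave_onD[OF profile_concave, of "a / b" 0 b] dom ab by simp
  ultimately have "(a / b) * ?f b \<le> ?f a"
    using ab by simp
  then have "a / ?f a \<le> b / ?f b"
    using ab pos by (simp add: field_simps)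
  then show ?thesis
    using a b ab pos dom by (simp add: iso_profile_eq_real divide_ennreal ennreal_leI)
qed

text \<open>Capping at half the total measure is monotone and keeps arguments positive and below the
  total measure, so \<open>div_iso_profile_mono\<close> applies to the capped arguments.\<close>

lemma Phi_interior_mono_on:
  "mono_on {0<..<emeasure M (space M)} (Phi_interior M)"
proof (rule mono_onI)
  fix s t assume "s \<in> {0<..<emeasure M (space M)}" "t \<in> {0<..<emeasure M (space M)}" "s \<le> t"
  then show "Phi_interior M s \<le> Phi_interior M t"
    unfolding Phi_interior_def
    by (intro div_iso_profile_mono)
       (auto simp: min_less_iff_disj ennreal_zero_less_divide intro: min.coboundedI1)
qed

text \<open>The endpoint is included because a sublevel set of \<open>w\<close> may have full
  measure. The left limit there is the supremum of the interior values, hence dominates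
  them.\<close>

lemma Phi_mono:
  assumes "s \<le> t" "t \<le> emeasure M (space M)"
  shows "Phi M s \<le> Phi M t"
proof (cases "s = 0")
  case True
  then show ?thesis by (simp add: Phi_def)
next
  case False
  then have "0 < s" "0 < t" and total: "0 < emeasure M (space M)"
    using assms by (auto simp: zero_less_iff_neq_zero)
  consider "t < emeasure M (space M)" | "s < t" "t = emeasure M (space M)" | "s = t"
    using assms by force
  then show ?thesis
  proof cases
    case 1
    then show ?thesis
      using \<open>0 < s\<close> \<open>0 < t\<close> assms mono_onD[OF Phi_interior_mono_on, of s t]
      by (auto simp: Phi_def)
  next
    case 2
    then have "Phi_interior M s \<le> (SUP x\<in>{0<..<emeasure M (space M)}. Phi_interior M x)"
      using \<open>0 < s\<close> by (intro SUP_upper) auto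
    then show ?thesis
      using 2 \<open>0 < s\<close> total
      by (auto simp: Phi_def Lim_at_left_eq_SUP[OF total Phi_interior_mono_on])
  qed simp
qed

end

text \<open>The two sets differ only where \<open>w x = 0\<close>: there \<open>1 / w x\<close> is 0
  by convention, so the point is missing on the left but present on the right. Such points form a
  null set.\<close>

lemma distribution_inverse:
  assumes "w \<in> borel_measurable M" "\<And>x. 0 \<le> w x" "AE x in M. 0 < w x" "0 < t"
  shows "distribution M (\<lambda>x. 1 / w x) t = emeasure M {x \<in> space M. w x < 1 / t}"
  unfolding distribution_def
proof (rule emeasure_eq_AE)
  show "AE x in M. x \<in> {x \<in> space M. t < \<bar>1 / w x\<bar>} \<longleftrightarrow> x \<in> {x \<in> space M. w x < 1 / t}"
    using assms(3) by eventually_elim (use \<open>0 < t\<close> in \<open>auto simp: field_simps\<close>)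
qed (use assms(1) in measurable)

theorem lemma1:
  fixes M :: "'a::metric_space measure" and w :: "'a \<Rightarrow> real"
  assumes "isoperimetric_space M"
    and "w \<in> borel_measurable M"
    and "\<And>x. 0 \<le> w x"
    and "AE x in M. 0 < w x"
  shows "isoperimetric_weight M w \<longleftrightarrow>
           (\<lambda>x. 1 / w x) \<in> marcinkiewicz_space M (Phi M)"
proof -
  interpret isoperimetric_space M by fact
  note [measurable] = assms(2)
  note distr = distribution_inverse[OF assms(2-4)]
  show ?thesis
  proof
    assume "isoperimetric_weight M w"
    then obtain C where C: "0 < C"
      "\<And>r. 0 < r \<Longrightarrow> Phi M (emeasure M {x \<in> space M. w x \<le> r}) \<le> ennreal (C * r)"
      by (auto simp: isoperimetric_weight_def)
    have "ennreal t * Phi M (distribution M (\<lambda>x. 1 / w x) t) \<le> ennreal C" if "0 < t" for t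
    proof -
      have "Phi M (distribution M (\<lambda>x. 1 / w x) t)
          \<le> Phi M (emeasure M {x \<in> space M. w x \<le> 1 / t})"
        unfolding distr[OF that] by (intro Phi_mono emeasure_mono emeasure_space) auto
      also have "\<dots> \<le> ennreal (C * (1 / t))"
        using that by (intro C(2)) simp
      finally have "ennreal t * Phi M (distribution M (\<lambda>x. 1 / w x) t)
          \<le> ennreal t * ennreal (C * (1 / t))"
        by (rule mult_left_mono) simp
      also have "\<dots> = ennreal C"
        using that C(1) by (simp flip: ennreal_mult)
      finally show ?thesis .
    qed
    then have "marcinkiewicz_norm M (Phi M) (\<lambda>x. 1 / w x) \<le> ennreal C"
      unfolding marcinkiewicz_norm_def by (intro SUP_least) auto
    then show "(\<lambda>x. 1 / w x) \<in> marcinkiewicz_space M (Phi M)"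
      using le_less_trans[OF _ ennreal_less_top] by (simp add: marcinkiewicz_space_def)
  next
    assume "(\<lambda>x. 1 / w x) \<in> marcinkiewicz_space M (Phi M)"
    then obtain N where N: "marcinkiewicz_norm M (Phi M) (\<lambda>x. 1 / w x) = ennreal N" "0 \<le> N"
      by (cases "marcinkiewicz_norm M (Phi M) (\<lambda>x. 1 / w x)")
         (auto simp: marcinkiewicz_space_def)
    \<comment> \<open>The estimate gives \<open>2 * N\<close>; adding 1 makes the constant positive
      even if the norm is 0.\<close>
    have "Phi M (emeasure M {x \<in> space M. w x \<le> r}) \<le> ennreal ((2 * N + 1) * r)"
      if "0 < r" for r
    proof -
      \<comment> \<open>With this level the strict sublevel set is \<open>w x < 2 * r\<close>, which
        contains \<open>w x \<le> r\<close> since \<open>r > 0\<close>.\<close>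
      define t where "t = 1 / (2 * r)"
      have t: "0 < t" "1 / t = 2 * r"
        using that by (auto simp: t_def)
      have "Phi M (emeasure M {x \<in> space M. w x \<le> r})
          \<le> Phi M (distribution M (\<lambda>x. 1 / w x) t)"
        unfolding distr[OF t(1)] t(2)
        using that by (intro Phi_mono emeasure_mono emeasure_space) auto
      also have "\<dots> = ennreal (2 * r) * (ennreal t * Phi M (distribution M (\<lambda>x. 1 / w x) t))"
        using that by (simp add: t_def flip: ennreal_mult mult.assoc)
      also have "\<dots> \<le> ennreal (2 * r) * ennreal N"
        unfolding N(1)[symmetric] marcinkiewicz_norm_def
        by (intro mult_left_mono SUP_upper) (use t(1) in auto)
      also have "\<dots> = ennreal (2 * r * N)"
        using that N(2) by (simp add: ennreal_mult)
      also have "\<dots> \<le> ennreal ((2 * N + 1) * r)"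
        using that by (intro ennreal_leI) (simp add: algebra_simps)
      finally show ?thesis .
    qed
    moreover have "0 < 2 * N + 1"
      using N(2) by simp
    ultimately show "isoperimetric_weight M w"
      using assms unfolding isoperimetric_weight_def by blast
  qed
qed

end
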